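(* Let $X$ be a discrete memoryless source with finite alphabet $\mathcal{X}$ and entropy $H(X)$. Then for every normalized list size $0\le L\le 1$, the rate list function $R(L)$ of $X$ satisfies $$R(L)\ \ge\ H(X)-L\log|\mathcal{X}|.$$
   Context: All logarithms and entropies are in base 2. $X$ has finite alphabet $\mathcal{X}$ ($|\mathcal{X}|\ge 2$) and distribution $p_X$; $X^n=(X_1,\dots,X_n)$ is a vector of i.i.d. copies of $X$. A $(2^{nR},|\mathcal{X}|^{nL},n)$-list-source code (with $2^{nR}$ and $|\mathcal{X}|^{nL}$ positive integers, $0\le L\le 1$) consists of an encoding function $f_n:\mathcal{X}^n\to\{1,\dots,2^{nR}\}$ and a list-decoding function $g_n:\{1,\dots,2^{nR}\}\to\mathcal{P}(\mathcal{X}^n)\setminus\{\varnothing\}$ such that $|g_n(w)|=|\mathcal{X}|^{nL}$ for all $w$. Here $\mathcal{P}$ denotes the power set. Its error probability is $e_L(f_n,g_n)=\Pr(X^n\notin g_n(f_n(X^n)))$. A pair $(R,L)$ is achievable if for every $\delta>0$, every $0<\epsilon<1$ and all sufficiently large $n$ there is a $(2^{nR_n},|\mathcal{X}|^{nL_n},n)$-list-source code $(f_n,g_n)$ with $R_n<R+\delta$, $|L_n-L|<\delta$ and $e_{L_n}(f_n,g_n)\le\epsilon$. The rate list region is the closure of the set of achievable pairs $(R,L)$. The rate list function is $R(L)=\inf\{R:(R,L)\text{ is in the rate list region}\}$, for $0\le L\le 1$. *)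

theory Defs
  imports "HOL-Probability.Probability"
begin

text \<open>
  A source over a finite alphabet is given by the distribution \<open>p\<close> of \<open>X\<close> on a finite type
  \<open>'a\<close>. Source words in \<open>\<X>\<^sup>n\<close> are lists of length \<open>n\<close>, and \<open>X\<^sup>n\<close> has law
  \<^term>\<open>replicate_pmf n p\<close>.
\<close>

definition source_entropy :: "'a::finite pmf \<Rightarrow> real" where
  "source_entropy p = prob_space.entropy (measure_pmf p) 2 (count_space UNIV) (\<lambda>x. x)"

lemma source_entropy_eq:
  "source_entropy p = - (\<Sum>x\<in>UNIV. pmf p x * log 2 (pmf p x))"
proof -
  interpret information_space "measure_pmf p" 2
    by unfold_locales simp
  have "distributed (measure_pmf p) (count_space UNIV) (\<lambda>x. x) (pmf p)"
    by (simp add: distributed_def distr_id2 measure_pmf_eq_density[symmetric])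
  then show ?thesis
    unfolding source_entropy_def
    by (subst entropy_distr[where f = "pmf p"])
       (auto simp: lebesgue_integral_count_space_finite sigma_finite_measure_count_space_finite)
qed

definition words :: "nat \<Rightarrow> 'a list set" where
  "words n = {xs. length xs = n}"

text \<open>
  The parameters \<open>R\<close> and \<open>L\<close> are real; \<open>M\<close> and \<open>K\<close> are the
  integers \<open>2 powr (n R)\<close> and \<open>\<bar>\<X>\<bar> powr (n L)\<close>. Only the values of \<open>f\<close> on
  \<^term>\<open>words n\<close> and of \<open>g\<close> on \<open>{1..M}\<close> matter.
\<close>

definition list_source_code ::
  "real \<Rightarrow> real \<Rightarrow> nat \<Rightarrow> ('a::finite list \<Rightarrow> nat) \<Rightarrow> (nat \<Rightarrow> 'a list set) \<Rightarrow> bool" where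
  "list_source_code R L n f g \<longleftrightarrow>
     0 \<le> L \<and> L \<le> 1 \<and>
     (\<exists>M K :: nat. 0 < M \<and> 0 < K \<and>
        real M = 2 powr (real n * R) \<and>
        real K = real CARD('a) powr (real n * L) \<and>
        f \<in> words n \<rightarrow> {1..M} \<and>
        g \<in> {1..M} \<rightarrow> Pow (words n) - {{}} \<and>
        (\<forall>w\<in>{1..M}. card (g w) = K))"

definition error_prob ::
  "'a pmf \<Rightarrow> nat \<Rightarrow> ('a list \<Rightarrow> nat) \<Rightarrow> (nat \<Rightarrow> 'a list set) \<Rightarrow> real" where
  "error_prob p n f g = measure_pmf.prob (replicate_pmf n p) {xs. xs \<notin> g (f xs)}"

definition achievable :: "'a::finite pmf \<Rightarrow> real \<Rightarrow> real \<Rightarrow> bool" where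
  "achievable p R L \<longleftrightarrow>
     (\<forall>\<delta>>0. \<forall>\<epsilon>. 0 < \<epsilon> \<and> \<epsilon> < 1 \<longrightarrow>
        (\<forall>\<^sub>F n in sequentially. \<exists>R' L' f g.
           list_source_code R' L' n f g \<and> R' < R + \<delta> \<and> \<bar>L' - L\<bar> < \<delta> \<and>
           error_prob p n f g \<le> \<epsilon>))"

definition rate_list_region :: "'a::finite pmf \<Rightarrow> (real \<times> real) set" where
  "rate_list_region p = closure {(R, L). achievable p R L}"

text \<open>
  For \<open>0 \<le> L \<le> 1\<close> the set below is nonempty and bounded below by \<open>0\<close>, so that the infimum
  over the reals is the intended one: \<^prop>\<open>achievable p R L\<close> forces \<open>R \<ge> 0\<close>, and an
  injective encoding shows that \<open>R = log 2 \<bar>\<X>\<bar>\<close> is always achievable.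
\<close>

definition rate_list :: "'a::finite pmf \<Rightarrow> real \<Rightarrow> real" where
  "rate_list p L = Inf {R. (R, L) \<in> rate_list_region p}"

end

theory Submission
  imports Defs
begin

text \<open>
  The correctly decoded words number at most \<open>2 powr (n R) * \<bar>\<X>\<bar> powr (n L)\<close>. For \<open>a < H(X)\<close> each word
  either has probability at most \<open>2 powr (- n a)\<close> or lies in the set of atypically likely words,
  whose probability decays exponentially by a Chernoff bound: the function
  \<open>s \<mapsto> \<Sum>x. p(x) exp (s (ln p(x) + a ln 2))\<close> has value \<open>1\<close> and negative derivative at \<open>0\<close>. Hence
  if \<open>R + L log \<bar>\<X>\<bar> < a\<close>, the probability of correct decoding tends to \<open>0\<close>. The bound on achievable
  pairs is a closed condition, so it passes to the closure.
\<close>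

section \<open>Words of length n and their product law\<close>

lemma words_0: "words 0 = {[]}"
  by (auto simp: words_def)

lemma words_Suc: "words (Suc n) = (\<lambda>(x, xs). x # xs) ` (UNIV \<times> words n)"
  by (auto simp: words_def length_Suc_conv image_iff)

lemma finite_words [simp]: "finite (words n :: 'a::finite list set)"
  by (induction n) (simp_all add: words_0 words_Suc)

lemma card_words: "card (words n :: 'a::finite list set) = CARD('a) ^ n"
  using card_lists_length_eq[of "UNIV :: 'a set" n] by (simp add: words_def)

text \<open>Distributive law. Applied to exponentially tilted letter weights, it turns a sum over
  all words into an n-th power, which is the source of the geometric decay.\<close>

lemma sum_prod_list_words:
  fixes h :: "'a::finite \<Rightarrow> 'b::comm_semiring_1"
  shows "(\<Sum>xs\<in>words n. prod_list (map h xs)) = (\<Sum>x\<in>UNIV. h x) ^ n"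
proof (induction n)
  case 0
  show ?case by (simp add: words_0)
next
  case (Suc n)
  have "(\<Sum>xs\<in>words (Suc n). prod_list (map h xs)) =
      (\<Sum>(x, xs)\<in>UNIV \<times> words n. h x * prod_list (map h xs))"
    unfolding words_Suc
    by (subst sum.reindex) (auto simp: inj_on_def case_prod_unfold)
  also have "\<dots> = (\<Sum>x\<in>UNIV. h x) * (\<Sum>xs\<in>words n. prod_list (map h xs))"
    by (simp add: sum_product sum.cartesian_product)
  finally show ?case using Suc by simp
qed

lemma pmf_replicate_pmf:
  "length xs = n \<Longrightarrow> pmf (replicate_pmf n p) xs = prod_list (map (pmf p) xs)"
proof (induction n arbitrary: xs)
  case 0
  then show ?case by simp
next
  case (Suc n)
  then obtain y ys where xs: "xs = y # ys" "length ys = n"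
    by (auto simp: length_Suc_conv)
  \<comment> \<open>As the image of a product law under an injective map, the law of the longer word
    factors into first letter and tail.\<close>
  have "replicate_pmf (Suc n) p = map_pmf (\<lambda>(x, xs). x # xs) (pair_pmf p (replicate_pmf n p))"
    by (simp add: pair_pmf_def map_pmf_def bind_assoc_pmf bind_return_pmf)
  moreover have "inj (\<lambda>(x, xs). x # xs :: 'a list)"
    by (auto simp: inj_def)
  ultimately have "pmf (replicate_pmf (Suc n) p) xs = pmf (pair_pmf p (replicate_pmf n p)) (y, ys)"
    using pmf_map_inj'[of "\<lambda>(x, xs). x # xs" "pair_pmf p (replicate_pmf n p)" "(y, ys)"] xs
    by simp
  then show ?case using Suc xs by (simp add: pmf_pair)
qed

lemma prob_replicate_pmf:
  fixes p :: "'a::finite pmf"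
  assumes "C \<subseteq> words n"
  shows "measure_pmf.prob (replicate_pmf n p) C = (\<Sum>xs\<in>C. prod_list (map (pmf p) xs))"
proof -
  have "finite C" using assms finite_words by (rule finite_subset)
  then show ?thesis
    using assms by (auto simp: measure_measure_pmf_finite pmf_replicate_pmf words_def intro!: sum.cong)
qed

section \<open>Chernoff bound for atypically likely words\<close>

text \<open>Chernoff's argument word by word: above the threshold \<open>2 powr (- n a)\<close> the
  summed exponent is nonnegative, so the tilting factor is at least 1; below it the first summand
  suffices.\<close>

lemma prod_list_tilt:
  fixes q :: "'a \<Rightarrow> real"
  assumes q: "\<And>x. q x \<ge> 0" and s: "s \<ge> 0"
  shows "prod_list (map q xs) \<le> 2 powr (- real (length xs) * a) +
           prod_list (map (\<lambda>x. q x * exp (s * (ln (q x) + a * ln 2))) xs)"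
proof -
  let ?c = "\<lambda>x. ln (q x) + a * ln 2"
  let ?t = "prod_list (map q xs)"
  have tilt: "prod_list (map (\<lambda>x. q x * exp (s * ?c x)) xs) = ?t * exp (s * sum_list (map ?c xs))"
    by (induction xs) (simp_all add: exp_add algebra_simps)
  have t0: "?t \<ge> 0" using q by (intro prod_list_nonneg) auto
  show ?thesis
  proof (cases "?t \<le> 2 powr (- real (length xs) * a)")
    case True
    then show ?thesis unfolding tilt using t0 by (simp add: add_increasing2)
  next
    case False
    have "0 < 2 powr (- real (length xs) * a)" by simp
    then have pos: "?t > 0" using False by linarith
    \<comment> \<open>\<open>ln\<close> turns the product into a sum only for positive factors; a
      word with a letter of weight 0 has product 0 and belongs to the first case.\<close>
    then have "\<forall>x\<in>set xs. q x > 0"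
      using q by (auto simp: prod_list_zero_iff order_less_le image_iff)
    then have "?t > 0 \<and> ln ?t = sum_list (map (\<lambda>x. ln (q x)) xs)"
      by (induction xs) (auto simp: ln_mult)
    then have "sum_list (map ?c xs) = ln ?t + real (length xs) * a * ln 2"
      by (simp add: sum_list_addf sum_list_triv)
    moreover have "ln ?t > ln (2 powr (- real (length xs) * a))"
      using False pos by (subst ln_less_cancel_iff) auto
    ultimately have "sum_list (map ?c xs) \<ge> 0" by (simp add: ln_powr)
    then have "1 \<le> exp (s * sum_list (map ?c xs))" using s by simp
    then have "?t \<le> ?t * exp (s * sum_list (map ?c xs))"
      using t0 mult_left_mono by fastforce
    then show ?thesis unfolding tilt by (simp add: add_increasing)
  qed
qed

text \<open>Summing the tilting bound over \<open>C\<close>. The base \<open>r\<close> is obtained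
  before \<open>n\<close> and \<open>C\<close>, so it serves all block lengths and all sets of words
  at once.\<close>

lemma prob_words_le:
  fixes p :: "'a::finite pmf"
  assumes a: "a < source_entropy p"
  obtains r where "0 \<le> r" "r < 1"
    "\<And>n C. C \<subseteq> words n \<Longrightarrow>
       measure_pmf.prob (replicate_pmf n p) C \<le> real (card C) * 2 powr (- real n * a) + r ^ n"
proof -
  define h where "h = (\<lambda>s x. pmf p x * exp (s * (ln (pmf p x) + a * ln 2)))"
  define \<phi> where "\<phi> = (\<lambda>s. \<Sum>x\<in>UNIV. h s x)"
  have sum1: "(\<Sum>x\<in>UNIV. pmf p x) = 1"
    by (rule sum_pmf_eq_1) auto
  have \<phi>0: "\<phi> 0 = 1" by (simp add: \<phi>_def h_def sum1)
  \<comment> \<open>At 0 the exponential factor is 1, which leaves the mean of the exponent. Letters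
    of probability 0 contribute nothing because of the factor \<open>pmf p x\<close>, whatever the
    value of \<open>ln 0\<close>.\<close>
  have "(\<phi> has_real_derivative (\<Sum>x\<in>UNIV. pmf p x * (ln (pmf p x) + a * ln 2))) (at 0)"
    unfolding \<phi>_def h_def by (auto intro!: derivative_eq_intros sum.cong)
  moreover have "(\<Sum>x\<in>UNIV. pmf p x * (ln (pmf p x) + a * ln 2)) = (a - source_entropy p) * ln 2"
  proof -
    have "ln 2 * (\<Sum>x\<in>UNIV. pmf p x * log 2 (pmf p x)) = (\<Sum>x\<in>UNIV. pmf p x * ln (pmf p x))"
      by (simp add: sum_distrib_left log_def)
    moreover have "(\<Sum>x\<in>UNIV. pmf p x * (a * ln 2)) = a * ln 2"
      by (simp add: sum_distrib_right[symmetric] sum1)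
    ultimately show ?thesis
      by (simp add: source_entropy_eq algebra_simps sum.distrib)
  qed
  ultimately obtain d where d: "d > 0" "\<And>s. s > 0 \<Longrightarrow> s < d \<Longrightarrow> \<phi> (0 + s) < \<phi> 0"
    using a DERIV_neg_dec_right[of \<phi> "(a - source_entropy p) * ln 2" 0]
    by (auto simp: mult_neg_pos)
  \<comment> \<open>Any point strictly between 0 and \<open>d\<close> would serve.\<close>
  define s where "s = d / 2"
  have s: "s > 0" "\<phi> s < 1" using d(1) d(2)[of s] by (auto simp: s_def \<phi>0)
  show ?thesis
  proof (rule that[of "\<phi> s"])
    show "0 \<le> \<phi> s" by (simp add: \<phi>_def h_def sum_nonneg)
    show "\<phi> s < 1" by (fact s)
    fix n and C :: "'a list set"
    assume C: "C \<subseteq> words n"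
    have "measure_pmf.prob (replicate_pmf n p) C = (\<Sum>xs\<in>C. prod_list (map (pmf p) xs))"
      by (rule prob_replicate_pmf[OF C])
    also have "\<dots> \<le> (\<Sum>xs\<in>C. 2 powr (- real n * a) + prod_list (map (h s) xs))"
    proof (rule sum_mono)
      fix xs assume "xs \<in> C"
      then have "length xs = n" using C by (auto simp: words_def)
      then show "prod_list (map (pmf p) xs) \<le> 2 powr (- real n * a) + prod_list (map (h s) xs)"
        using prod_list_tilt[of "pmf p" s xs a] s by (simp add: h_def)
    qed
    also have "\<dots> = real (card C) * 2 powr (- real n * a) + (\<Sum>xs\<in>C. prod_list (map (h s) xs))"
      by (simp add: sum.distrib)
    \<comment> \<open>The tilted weights are nonnegative, so \<open>C\<close> may be enlarged to all
      words, where the sum factors.\<close>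
    also have "(\<Sum>xs\<in>C. prod_list (map (h s) xs)) \<le> (\<Sum>xs\<in>words n. prod_list (map (h s) xs))"
      using C by (intro sum_mono2 prod_list_nonneg) (auto simp: h_def)
    also have "\<dots> = \<phi> s ^ n" by (simp add: sum_prod_list_words \<phi>_def)
    finally show "measure_pmf.prob (replicate_pmf n p) C
        \<le> real (card C) * 2 powr (- real n * a) + \<phi> s ^ n" by simp
  qed
qed

section \<open>Converse for achievable pairs\<close>

text \<open>Every correctly decoded word lies in one of the \<open>M\<close> lists of
  \<open>K\<close> words, so there are at most \<open>M * K\<close> of them; a change of base writes
  this product as a single power of 2.\<close>

lemma card_decodable_le:
  fixes f :: "'a::finite list \<Rightarrow> nat"
  assumes "list_source_code R L n f g"
  shows "real (card {xs \<in> words n. xs \<in> g (f xs)}) \<le> 2 powr (real n * (R + L * log 2 (real CARD('a))))"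
proof -
  obtain M K where MK: "real M = 2 powr (real n * R)"
      "real K = real CARD('a) powr (real n * L)" "f \<in> words n \<rightarrow> {1..M}"
      "g \<in> {1..M} \<rightarrow> Pow (words n) - {{}}" "\<forall>w\<in>{1..M}. card (g w) = K"
    using assms unfolding list_source_code_def by blast
  have "finite (\<Union>w\<in>{1..M}. g w)"
  proof (rule finite_subset)
    show "(\<Union>w\<in>{1..M}. g w) \<subseteq> words n" using MK(4) by blast
  qed simp
  moreover have "{xs \<in> words n. xs \<in> g (f xs)} \<subseteq> (\<Union>w\<in>{1..M}. g w)"
    using MK(3) by auto
  ultimately have "card {xs \<in> words n. xs \<in> g (f xs)} \<le> card (\<Union>w\<in>{1..M}. g w)"
    by (rule card_mono)
  also have "\<dots> \<le> (\<Sum>w\<in>{1..M}. card (g w))"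
    by (rule card_UN_le) simp
  also have "\<dots> = M * K" using MK(5) by simp
  finally have "real (card {xs \<in> words n. xs \<in> g (f xs)}) \<le> real M * real K"
    by (metis of_nat_le_iff of_nat_mult)
  also have "real K = 2 powr (real n * (L * log 2 (real CARD('a))))"
  proof -
    have "real CARD('a) = 2 powr log 2 (real CARD('a))"
      by simp
    then show ?thesis unfolding MK(2) by (metis powr_powr mult.commute mult.left_commute)
  qed
  also have "real M * \<dots> = 2 powr (real n * (R + L * log 2 (real CARD('a))))"
    unfolding MK(1) by (simp add: powr_add[symmetric] algebra_simps)
  finally show ?thesis .
qed

text \<open>The error event contains lists of every length, whereas a code is constrained only on
  \<open>words n\<close>; the two agree almost surely since the law is supported there.\<close>

lemma error_prob_eq:
  fixes p :: "'a::finite pmf"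
  shows "error_prob p n f g = 1 - measure_pmf.prob (replicate_pmf n p) {xs \<in> words n. xs \<in> g (f xs)}"
proof -
  have "error_prob p n f g = measure_pmf.prob (replicate_pmf n p) (UNIV - {xs \<in> words n. xs \<in> g (f xs)})"
    unfolding error_prob_def
    by (rule measure_pmf.finite_measure_eq_AE)
       (auto simp: AE_measure_pmf_iff set_replicate_pmf words_def)
  then show ?thesis
    using measure_pmf.prob_compl[of "{xs \<in> words n. xs \<in> g (f xs)}" "replicate_pmf n p"] by simp
qed

lemma achievable_lower_bound:
  fixes p :: "'a::finite pmf"
  assumes ach: "achievable p R L"
  shows "source_entropy p \<le> R + L * log 2 (real CARD('a))"
proof (rule ccontr)
  define l where "l = log 2 (real CARD('a))"
  define D where "D = source_entropy p - (R + L * l)"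
  assume "\<not> ?thesis"
  then have D: "D > 0" by (simp add: D_def l_def)
  have l: "l \<ge> 0" by (simp add: l_def Suc_leI)
  \<comment> \<open>The gap \<open>D\<close> is split into thirds: one separates \<open>a\<close>
    from the entropy, one pays for the slack \<delta> in rate and list size (hence the factor
    \<open>1 + l\<close>), and one remains as the decay exponent in \<open>u\<close>.\<close>
  define a where "a = source_entropy p - D / 3"
  define \<delta> where "\<delta> = D / (3 * (1 + l))"
  have \<delta>: "\<delta> > 0" "\<delta> * (1 + l) = D / 3" using D l by (simp_all add: \<delta>_def field_simps)
  have "a < source_entropy p" using D by (simp add: a_def)
  then obtain r where r: "0 \<le> r" "r < 1" and prob_le:
    "\<And>n C. C \<subseteq> words n \<Longrightarrow>
       measure_pmf.prob (replicate_pmf n p) C \<le> real (card C) * 2 powr (- real n * a) + r ^ n"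
    using prob_words_le[of a p] by blast
  define u where "u = 2 powr (- D / 3)"
  have u: "0 \<le> u" "u < 1" using D by (simp_all add: u_def powr_less_one)
  have "(\<lambda>n. u ^ n + r ^ n) \<longlonglongrightarrow> 0 + 0"
    using u r by (intro tendsto_add LIMSEQ_power_zero) auto
  \<comment> \<open>Error at most 1/2 will force correct decoding with probability at least 1/2,
    against this bound.\<close>
  then have "\<forall>\<^sub>F n in sequentially. u ^ n + r ^ n < 1 / 2"
    by (rule order_tendstoD) simp
  moreover have "\<forall>\<^sub>F n in sequentially. \<exists>R' L' f g. list_source_code R' L' n f g \<and> R' < R + \<delta> \<and>
      \<bar>L' - L\<bar> < \<delta> \<and> error_prob p n f g \<le> 1 / 2"
    using ach[unfolded achievable_def, rule_format, OF \<delta>(1), of "1/2"] by simp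
  ultimately have "\<forall>\<^sub>F n in sequentially. False"
  proof eventually_elim
    case (elim n)
    then obtain R' L' f g where code: "list_source_code R' L' n f g" and
      R': "R' < R + \<delta>" and L': "\<bar>L' - L\<bar> < \<delta>" and err: "error_prob p n f g \<le> 1 / 2" by blast
    let ?C = "{xs \<in> words n. xs \<in> g (f xs)}"
    have "L' * l \<le> (L + \<delta>) * l" using L' l by (intro mult_right_mono) auto
    then have "R' + L' * l \<le> R + L * l + \<delta> * (1 + l)"
      using R' by (simp add: algebra_simps)
    moreover have "R + L * l = source_entropy p - D" by (simp add: D_def)
    ultimately have rate: "R' + L' * l \<le> a - D / 3"
      unfolding \<delta>(2) a_def by linarith
    have "1 / 2 \<le> measure_pmf.prob (replicate_pmf n p) ?C"
      using err by (simp add: error_prob_eq)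
    also have "\<dots> \<le> real (card ?C) * 2 powr (- real n * a) + r ^ n"
      by (rule prob_le) auto
    also have "real (card ?C) * 2 powr (- real n * a) \<le>
        2 powr (real n * (R' + L' * l)) * 2 powr (- real n * a)"
      using card_decodable_le[OF code] by (intro mult_right_mono) (auto simp: l_def)
    also have "\<dots> = 2 powr (real n * (R' + L' * l - a))"
      by (simp add: powr_add[symmetric] algebra_simps)
    also have "\<dots> \<le> 2 powr (real n * (- D / 3))"
      using rate by (intro powr_mono mult_left_mono) auto
    also have "\<dots> = u ^ n"
      unfolding u_def by (simp add: powr_power mult.commute)
    finally show ?case using elim by simp
  qed
  then show False by simp
qed

lemma rate_list_region_lower_bound:
  fixes p :: "'a::finite pmf"
  assumes "(R, L) \<in> rate_list_region p"
  shows "source_entropy p \<le> R + L * log 2 (real CARD('a))"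
proof -
  let ?S = "{z :: real \<times> real. source_entropy p \<le> fst z + snd z * log 2 (real CARD('a))}"
  have "closed ?S" by (intro closed_Collect_le continuous_intros)
  moreover have "{(R, L). achievable p R L} \<subseteq> ?S" by (auto dest: achievable_lower_bound)
  ultimately have "rate_list_region p \<subseteq> ?S"
    unfolding rate_list_region_def by (rule closure_minimal[rotated])
  then show ?thesis using assms by auto
qed

section \<open>Nonemptiness of the set of rates\<close>

text \<open>At rate log |X| the index already determines the word, so its list can be padded with
  arbitrary other words up to the prescribed size.\<close>

lemma exists_errorless_list_source_code:
  fixes p :: "'a::finite pmf"
  assumes q: "CARD('a) \<ge> 2" and n: "n > 0" and m: "m \<le> n"
  shows "\<exists>f g. list_source_code (log 2 (real CARD('a))) (real m / real n) n
           (f :: 'a list \<Rightarrow> nat) g \<and> error_prob p n f g = 0"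
proof -
  define M where "M = CARD('a) ^ n"
  define K where "K = CARD('a) ^ m"
  obtain f :: "'a list \<Rightarrow> nat" where f: "bij_betw f (words n) {1..M}"
    using finite_same_card_bij[of "words n :: 'a list set" "{1..M}"] by (auto simp: card_words M_def)
  have K: "0 < K" "K \<le> M" using q m by (auto simp: K_def M_def intro: power_increasing)
  have "\<exists>S. xs \<in> S \<and> S \<subseteq> words n \<and> card S = K" if "xs \<in> words n" for xs :: "'a list"
    using exists_subset_between[of "{xs}" K "words n"] that K by (auto simp: card_words M_def)
  then obtain G where G: "\<And>xs :: 'a list. xs \<in> words n \<Longrightarrow> xs \<in> G xs \<and> G xs \<subseteq> words n \<and> card (G xs) = K"
    by metis
  define g where "g = (\<lambda>w. G (inv_into (words n) f w))"
  have inv: "inv_into (words n) f w \<in> words n" if "w \<in> {1..M}" for w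
    using f that by (auto simp: bij_betw_def intro: inv_into_into)
  have gf: "xs \<in> g (f xs)" if "xs \<in> words n" for xs
    using G[OF that] f that by (simp add: g_def bij_betw_inv_into_left)
  have g: "g w \<in> Pow (words n) - {{}}" "card (g w) = K" if "w \<in> {1..M}" for w
    using G[OF inv[OF that]] by (auto simp: g_def)
  have M: "real M = 2 powr (real n * log 2 (real CARD('a)))"
    using q by (simp add: M_def powr_powr[symmetric] mult.commute[of "real n"] powr_realpow)
  have KL: "real K = real CARD('a) powr (real n * (real m / real n))"
    using n by (simp add: K_def powr_realpow)
  have "f \<in> words n \<rightarrow> {1..M}" using f by (auto simp: bij_betw_def)
  moreover have "g \<in> {1..M} \<rightarrow> Pow (words n) - {{}}" using g by auto
  ultimately have "list_source_code (log 2 (real CARD('a))) (real m / real n) n f g"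
    unfolding list_source_code_def using M KL K m n g(2) by (intro conjI exI[of _ M] exI[of _ K]) auto
  moreover have "error_prob p n f g = 0"
    unfolding error_prob_def using gf
    by (auto simp: measure_pmf_zero_iff set_replicate_pmf words_def)
  ultimately show ?thesis by blast
qed

lemma achievable_log_card:
  fixes p :: "'a::finite pmf"
  assumes q: "CARD('a) \<ge> 2" and L: "0 \<le> L" "L \<le> 1"
  shows "achievable p (log 2 (real CARD('a))) L"
  unfolding achievable_def
proof (intro allI impI)
  fix \<delta> \<epsilon> :: real
  assume \<delta>: "0 < \<delta>" and \<epsilon>: "0 < \<epsilon> \<and> \<epsilon> < 1"
  have "(\<lambda>n. 1 / real n) \<longlonglongrightarrow> 0" by (rule lim_1_over_n)
  then have "\<forall>\<^sub>F n in sequentially. 1 / real n < \<delta>" using \<delta> by (rule order_tendstoD)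
  moreover have "\<forall>\<^sub>F n in sequentially. (0::nat) < n" by (rule eventually_gt_at_top)
  ultimately show "\<forall>\<^sub>F n in sequentially. \<exists>R' L' f g. list_source_code R' L' n f g \<and>
      R' < log 2 (real CARD('a)) + \<delta> \<and> \<bar>L' - L\<bar> < \<delta> \<and> error_prob p n f g \<le> \<epsilon>"
  proof eventually_elim
    case (elim n)
    \<comment> \<open>Rounding down makes the list size an integral power of the alphabet size and
      moves the normalized list size by at most \<open>1 / n\<close>, which is eventually below
      \<delta>.\<close>
    define m where "m = nat \<lfloor>real n * L\<rfloor>"
    have "0 \<le> real n * L" "real n * L \<le> real n" using L by (simp_all add: mult_left_le)
    then have m: "real m \<le> real n * L" "real n * L < real m + 1" "m \<le> n"
      unfolding m_def by linarith+
    have "real m / real n \<le> L" "L \<le> real m / real n + 1 / real n"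
      using m elim by (simp_all add: add_divide_distrib[symmetric] field_simps)
    then have "\<bar>real m / real n - L\<bar> < \<delta>" using elim by linarith
    then show ?case
      using exists_errorless_list_source_code[OF q elim(2) m(3), of p] \<delta> \<epsilon> by fastforce
  qed
qed

theorem proposition1:
  fixes p :: "'a::finite pmf" and L :: real
  assumes "CARD('a) \<ge> 2" and "0 \<le> L" and "L \<le> 1"
  shows "rate_list p L \<ge> source_entropy p - L * log 2 (real CARD('a))"
  unfolding rate_list_def
proof (rule cInf_greatest)
  \<comment> \<open>A lower bound of a set of reals bounds its \<open>Inf\<close> only if the set is
    nonempty; this pair is the witness.\<close>
  have "(log 2 (real CARD('a)), L) \<in> rate_list_region p"
    using achievable_log_card[OF assms, of p] closure_subset[of "{(R, L). achievable p R L}"]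
    by (auto simp: rate_list_region_def)
  then show "{R. (R, L) \<in> rate_list_region p} \<noteq> {}" by blast
qed (auto dest: rate_list_region_lower_bound)

end
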